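(* Let $R$ be an abelian and right quasi-continuous ring, and let $Q^r_{\mathrm{max}}(R)$ be its maximal right ring of quotients. Then the condition (4) $R$ is uniquely special almost clean is equivalent to each of the following (mutually equivalent) conditions: (1) $R$ is right nonsingular; (2) $Q^r_{\mathrm{max}}(R)$ is unit-regular; (3) $R$ is Rickart.
   Context: Rings are associative with identity. A ring is abelian if all of its idempotents are central. $R$ is right quasi-continuous if the right module $M=R_R$ satisfies (C1) every submodule of $M$ is essential in a direct summand of $M$, and (C3) if $A$ and $B$ are direct summands of $M$ with $A\cap B=0$, then $A\oplus B$ is also a direct summand of $M$. $R$ is right nonsingular if no nonzero element of $R$ has an essential right ideal as its right annihilator. A ring $Q$ is unit-regular if for each $a\in Q$ there is a unit $u\in Q$ with $a=aua$. A ring is right (left) Rickart if the right (left) annihilator of each element is generated, as a right (left) ideal, by an idempotent; it is Rickart if it is both left and right Rickart. An element of a ring is regular if it is neither a left nor a right zero-divisor. A special almost clean decomposition of $a\in R$ is an expression $a=u+e$ with $u$ a regular element, $e$ an idempotent, and $aR\cap eR=0$. $R$ is uniquely special almost clean if every element has exactly one special almost clean decomposition. *)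

theory Defs
  imports "HOL-Algebra.Ideal"
begin

section \<open>Right ideals as submodules of the right regular module\<close>

definition right_ideal :: "('a, 'm) ring_scheme \<Rightarrow> 'a set \<Rightarrow> bool" where
  "right_ideal R I \<longleftrightarrow>
     additive_subgroup I R \<and> (\<forall>x\<in>I. \<forall>r\<in>carrier R. x \<otimes>\<^bsub>R\<^esub> r \<in> I)"

definition principal_right_ideal :: "('a, 'm) ring_scheme \<Rightarrow> 'a \<Rightarrow> 'a set" where
  "principal_right_ideal R a = (\<lambda>r. a \<otimes>\<^bsub>R\<^esub> r) ` carrier R"

definition principal_left_ideal :: "('a, 'm) ring_scheme \<Rightarrow> 'a \<Rightarrow> 'a set" where
  "principal_left_ideal R a = (\<lambda>r. r \<otimes>\<^bsub>R\<^esub> a) ` carrier R"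

definition right_annihilator :: "('a, 'm) ring_scheme \<Rightarrow> 'a \<Rightarrow> 'a set" where
  "right_annihilator R a = {x \<in> carrier R. a \<otimes>\<^bsub>R\<^esub> x = \<zero>\<^bsub>R\<^esub>}"

definition left_annihilator :: "('a, 'm) ring_scheme \<Rightarrow> 'a \<Rightarrow> 'a set" where
  "left_annihilator R a = {x \<in> carrier R. x \<otimes>\<^bsub>R\<^esub> a = \<zero>\<^bsub>R\<^esub>}"

definition essential_in :: "('a, 'm) ring_scheme \<Rightarrow> 'a set \<Rightarrow> 'a set \<Rightarrow> bool" where
  "essential_in R A B \<longleftrightarrow>
     right_ideal R A \<and> right_ideal R B \<and> A \<subseteq> B \<and>
     (\<forall>C. right_ideal R C \<and> C \<subseteq> B \<and> C \<noteq> {\<zero>\<^bsub>R\<^esub>} \<longrightarrow> A \<inter> C \<noteq> {\<zero>\<^bsub>R\<^esub>})"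

definition direct_summand :: "('a, 'm) ring_scheme \<Rightarrow> 'a set \<Rightarrow> bool" where
  "direct_summand R A \<longleftrightarrow>
     right_ideal R A \<and>
     (\<exists>B. right_ideal R B \<and> A \<inter> B = {\<zero>\<^bsub>R\<^esub>} \<and> A <+>\<^bsub>R\<^esub> B = carrier R)"


section \<open>Ring-theoretic conditions\<close>

definition idempotent :: "('a, 'm) ring_scheme \<Rightarrow> 'a \<Rightarrow> bool" where
  "idempotent R e \<longleftrightarrow> e \<in> carrier R \<and> e \<otimes>\<^bsub>R\<^esub> e = e"

definition abelian_ring :: "('a, 'm) ring_scheme \<Rightarrow> bool" where
  "abelian_ring R \<longleftrightarrow>
     (\<forall>e. idempotent R e \<longrightarrow> (\<forall>x\<in>carrier R. e \<otimes>\<^bsub>R\<^esub> x = x \<otimes>\<^bsub>R\<^esub> e))"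

definition right_C1 :: "('a, 'm) ring_scheme \<Rightarrow> bool" where
  "right_C1 R \<longleftrightarrow>
     (\<forall>A. right_ideal R A \<longrightarrow> (\<exists>B. direct_summand R B \<and> essential_in R A B))"

definition right_C3 :: "('a, 'm) ring_scheme \<Rightarrow> bool" where
  "right_C3 R \<longleftrightarrow>
     (\<forall>A B. direct_summand R A \<and> direct_summand R B \<and> A \<inter> B = {\<zero>\<^bsub>R\<^esub>}
        \<longrightarrow> direct_summand R (A <+>\<^bsub>R\<^esub> B))"

definition right_quasi_continuous :: "('a, 'm) ring_scheme \<Rightarrow> bool" where
  "right_quasi_continuous R \<longleftrightarrow> right_C1 R \<and> right_C3 R"

definition right_nonsingular :: "('a, 'm) ring_scheme \<Rightarrow> bool" where
  "right_nonsingular R \<longleftrightarrow>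
     (\<forall>a\<in>carrier R. a \<noteq> \<zero>\<^bsub>R\<^esub> \<longrightarrow> \<not> essential_in R (right_annihilator R a) (carrier R))"

definition unit_regular :: "('a, 'm) ring_scheme \<Rightarrow> bool" where
  "unit_regular Q \<longleftrightarrow>
     (\<forall>a\<in>carrier Q. \<exists>u\<in>Units Q. a = a \<otimes>\<^bsub>Q\<^esub> u \<otimes>\<^bsub>Q\<^esub> a)"

definition right_rickart :: "('a, 'm) ring_scheme \<Rightarrow> bool" where
  "right_rickart R \<longleftrightarrow>
     (\<forall>a\<in>carrier R. \<exists>e. idempotent R e \<and> right_annihilator R a = principal_right_ideal R e)"

definition left_rickart :: "('a, 'm) ring_scheme \<Rightarrow> bool" where
  "left_rickart R \<longleftrightarrow>
     (\<forall>a\<in>carrier R. \<exists>e. idempotent R e \<and> left_annihilator R a = principal_left_ideal R e)"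

definition rickart :: "('a, 'm) ring_scheme \<Rightarrow> bool" where
  "rickart R \<longleftrightarrow> right_rickart R \<and> left_rickart R"

definition left_zero_divisor :: "('a, 'm) ring_scheme \<Rightarrow> 'a \<Rightarrow> bool" where
  "left_zero_divisor R a \<longleftrightarrow> (\<exists>x\<in>carrier R. x \<noteq> \<zero>\<^bsub>R\<^esub> \<and> a \<otimes>\<^bsub>R\<^esub> x = \<zero>\<^bsub>R\<^esub>)"

definition right_zero_divisor :: "('a, 'm) ring_scheme \<Rightarrow> 'a \<Rightarrow> bool" where
  "right_zero_divisor R a \<longleftrightarrow> (\<exists>x\<in>carrier R. x \<noteq> \<zero>\<^bsub>R\<^esub> \<and> x \<otimes>\<^bsub>R\<^esub> a = \<zero>\<^bsub>R\<^esub>)"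

definition regular_element :: "('a, 'm) ring_scheme \<Rightarrow> 'a \<Rightarrow> bool" where
  "regular_element R a \<longleftrightarrow>
     a \<in> carrier R \<and> \<not> left_zero_divisor R a \<and> \<not> right_zero_divisor R a"

definition special_almost_clean_decomp ::
    "('a, 'm) ring_scheme \<Rightarrow> 'a \<Rightarrow> 'a \<Rightarrow> 'a \<Rightarrow> bool" where
  "special_almost_clean_decomp R a u e \<longleftrightarrow>
     regular_element R u \<and> idempotent R e \<and> a = u \<oplus>\<^bsub>R\<^esub> e \<and>
     principal_right_ideal R a \<inter> principal_right_ideal R e = {\<zero>\<^bsub>R\<^esub>}"

definition uniquely_special_almost_clean :: "('a, 'm) ring_scheme \<Rightarrow> bool" where
  "uniquely_special_almost_clean R \<longleftrightarrow>
     (\<forall>a\<in>carrier R. \<exists>!(u, e). special_almost_clean_decomp R a u e)"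


section \<open>The maximal right ring of quotients\<close>

text \<open>
  The maximal right ring of quotients is the direct limit of the groups of right \<open>R\<close>-linear maps
  \<open>D \<rightarrow> R\<close> over all dense right ideals \<open>D\<close>, ordered by reverse inclusion.  Its elements are classes
  of pairs \<open>(D, f)\<close>, two pairs being identified when they agree on some smaller dense right ideal.
  The maps are composed from right to left, so that an element \<open>a\<close> of \<open>R\<close> corresponds to the class
  of \<open>x \<mapsto> a x\<close>.
\<close>

definition dense_right_ideal :: "('a, 'm) ring_scheme \<Rightarrow> 'a set \<Rightarrow> bool" where
  "dense_right_ideal R D \<longleftrightarrow>
     right_ideal R D \<and>
     (\<forall>x\<in>carrier R. \<forall>y\<in>carrier R. x \<noteq> \<zero>\<^bsub>R\<^esub> \<longrightarrow>
        (\<exists>r\<in>carrier R. x \<otimes>\<^bsub>R\<^esub> r \<noteq> \<zero>\<^bsub>R\<^esub> \<and> y \<otimes>\<^bsub>R\<^esub> r \<in> D))"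

definition dense_homs :: "('a, 'm) ring_scheme \<Rightarrow> ('a set \<times> ('a \<Rightarrow> 'a)) set" where
  "dense_homs R =
     {(D, f). dense_right_ideal R D \<and> f \<in> D \<rightarrow>\<^sub>E carrier R \<and>
        (\<forall>x\<in>D. \<forall>y\<in>D. f (x \<oplus>\<^bsub>R\<^esub> y) = f x \<oplus>\<^bsub>R\<^esub> f y) \<and>
        (\<forall>x\<in>D. \<forall>r\<in>carrier R. f (x \<otimes>\<^bsub>R\<^esub> r) = f x \<otimes>\<^bsub>R\<^esub> r)}"

definition dense_hom_rel ::
    "('a, 'm) ring_scheme \<Rightarrow> (('a set \<times> ('a \<Rightarrow> 'a)) \<times> ('a set \<times> ('a \<Rightarrow> 'a))) set" where
  "dense_hom_rel R =
     {((D, f), (E, g)). (D, f) \<in> dense_homs R \<and> (E, g) \<in> dense_homs R \<and>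
        (\<exists>H. dense_right_ideal R H \<and> H \<subseteq> D \<inter> E \<and> (\<forall>x\<in>H. f x = g x))}"

definition dense_hom_class ::
    "('a, 'm) ring_scheme \<Rightarrow> 'a set \<Rightarrow> ('a \<Rightarrow> 'a) \<Rightarrow> ('a set \<times> ('a \<Rightarrow> 'a)) set" where
  "dense_hom_class R D f = dense_hom_rel R `` {(D, restrict f D)}"

definition max_right_quotient_ring ::
    "('a, 'm) ring_scheme \<Rightarrow> ('a set \<times> ('a \<Rightarrow> 'a)) set ring" where
  "max_right_quotient_ring R =
     \<lparr>carrier = dense_homs R // dense_hom_rel R,
      mult = (\<lambda>X Y. \<Union>(D, f)\<in>X. \<Union>(E, g)\<in>Y. dense_hom_class R {x \<in> E. g x \<in> D} (\<lambda>x. f (g x))),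
      one = dense_hom_class R (carrier R) (\<lambda>x. x),
      zero = dense_hom_class R (carrier R) (\<lambda>x. \<zero>\<^bsub>R\<^esub>),
      add = (\<lambda>X Y. \<Union>(D, f)\<in>X. \<Union>(E, g)\<in>Y. dense_hom_class R (D \<inter> E) (\<lambda>x. f x \<oplus>\<^bsub>R\<^esub> g x))\<rparr>"

end

theory Submission
  imports Defs
begin

text \<open>
  Direct summands of the right regular module are the right ideals \<open>e R\<close> with \<open>e\<close> idempotent, so
  condition (C1) embeds every right ideal essentially in some \<open>e R\<close>, and in an abelian ring this
  \<open>e\<close> is central.  All four conditions are shown to be equivalent to the right Rickart condition.

  If the ring is right nonsingular, then the right annihilator of \<open>a\<close> is equal to the \<open>e R\<close> in which
  it is essential (\<open>nonsingular_C1_right_rickart\<close>); conversely a proper \<open>e R\<close> is never essential.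
  An abelian right Rickart ring is reduced, which makes it left Rickart as well.
  In a special almost clean decomposition \<open>a = u + e\<close> the right annihilator of \<open>a\<close> is \<open>e R\<close>
  (\<open>special_almost_clean_right_annihilator\<close>).  Thus decompositions in an abelian ring are unique,
  and they exist for all elements exactly if the ring is right Rickart: the witness is \<open>u = a - e\<close>.

  For the quotient ring, let \<open>f : D \<rightarrow> R\<close> be a homomorphism on a dense right ideal of a right
  nonsingular ring.  Its kernel is \<open>D \<inter> e R\<close> for some idempotent \<open>e\<close>, and the map \<open>h = f + e\<close> is
  injective.  Since homomorphisms commute with central idempotents, the image of an injective one
  cannot lie in a proper summand and is therefore essential
  (\<open>injective_dense_hom_image_essential\<close>); so \<open>h\<close> becomes a unit of the
  quotient ring, and its inverse \<open>p\<close> satisfies \<open>f p f = f\<close>.  Conversely, if \<open>a = a q a\<close> in the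
  quotient ring and the right annihilator of \<open>a\<close> is essential, then \<open>q a\<close> has an essential annihilator; being
  idempotent it is zero, and with it \<open>a\<close>.
\<close>

section \<open>Right ideals and essentiality\<close>

context ring
begin

lemma right_idealI:
  assumes "I \<subseteq> carrier R" and "\<zero> \<in> I"
    and "\<And>x y. x \<in> I \<Longrightarrow> y \<in> I \<Longrightarrow> x \<oplus> y \<in> I"
    and "\<And>x r. x \<in> I \<Longrightarrow> r \<in> carrier R \<Longrightarrow> x \<otimes> r \<in> I"
  shows "right_ideal R I"
proof -
  have "\<ominus> x \<in> I" if "x \<in> I" for x
  proof -
    have "x \<otimes> (\<ominus> \<one>) \<in> I" using assms(4) that by simp
    moreover have "x \<otimes> (\<ominus> \<one>) = \<ominus> x" using assms(1) that by (simp add: r_minus subset_iff)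
    ultimately show ?thesis by simp
  qed
  then have "subgroup I (add_monoid R)"
    using assms by (intro add.subgroupI) (auto simp: a_inv_def)
  then show ?thesis
    using assms(4) by (simp add: right_ideal_def additive_subgroupI)
qed

lemma right_idealD:
  assumes "right_ideal R I"
  shows "I \<subseteq> carrier R" and "\<zero> \<in> I"
    and "\<And>x y. x \<in> I \<Longrightarrow> y \<in> I \<Longrightarrow> x \<oplus> y \<in> I"
    and "\<And>x y. x \<in> I \<Longrightarrow> y \<in> I \<Longrightarrow> x \<ominus> y \<in> I"
    and "\<And>x r. x \<in> I \<Longrightarrow> r \<in> carrier R \<Longrightarrow> x \<otimes> r \<in> I"
proof -
  interpret additive_subgroup I R using assms by (simp add: right_ideal_def)
  show "I \<subseteq> carrier R" "\<zero> \<in> I" by (auto simp: a_subset)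
  show "x \<oplus> y \<in> I" if "x \<in> I" "y \<in> I" for x y using that by simp
  show "x \<ominus> y \<in> I" if "x \<in> I" "y \<in> I" for x y
    using that by (simp add: a_minus_def a_inv_closed)
  show "x \<otimes> r \<in> I" if "x \<in> I" "r \<in> carrier R" for x r
    using assms that by (simp add: right_ideal_def)
qed

lemma right_ideal_carrier: "right_ideal R (carrier R)"
  by (rule right_idealI) auto

lemma right_ideal_right_annihilator:
  assumes "a \<in> carrier R"
  shows "right_ideal R (right_annihilator R a)"
  using assms
  by (intro right_idealI) (auto simp: right_annihilator_def r_distr m_assoc[symmetric])

lemma right_ideal_principal:
  assumes "a \<in> carrier R"
  shows "right_ideal R (principal_right_ideal R a)"
proof (rule right_idealI)
  show "\<zero> \<in> principal_right_ideal R a"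
    using assms by (auto simp: principal_right_ideal_def intro: image_eqI[where x = \<zero>])
next
  fix x y assume "x \<in> principal_right_ideal R a" "y \<in> principal_right_ideal R a"
  then show "x \<oplus> y \<in> principal_right_ideal R a"
    using assms by (auto simp: principal_right_ideal_def r_distr[symmetric])
next
  fix x r assume "x \<in> principal_right_ideal R a" "r \<in> carrier R"
  then show "x \<otimes> r \<in> principal_right_ideal R a"
    using assms by (auto simp: principal_right_ideal_def m_assoc)
qed (use assms in \<open>auto simp: principal_right_ideal_def\<close>)

text \<open>It suffices to test essentiality against the cyclic submodules \<open>y R\<close>.\<close>

lemma essential_in_iff:
  "essential_in R A B \<longleftrightarrow>
     right_ideal R A \<and> right_ideal R B \<and> A \<subseteq> B \<and>
     (\<forall>y\<in>B. y \<noteq> \<zero> \<longrightarrow> (\<exists>r\<in>carrier R. y \<otimes> r \<in> A \<and> y \<otimes> r \<noteq> \<zero>))"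
  (is "?lhs \<longleftrightarrow> ?rhs")
proof
  assume ess: ?lhs
  then have A: "right_ideal R A" and B: "right_ideal R B" and AB: "A \<subseteq> B"
    by (auto simp: essential_in_def)
  have "\<exists>r\<in>carrier R. y \<otimes> r \<in> A \<and> y \<otimes> r \<noteq> \<zero>" if y: "y \<in> B" "y \<noteq> \<zero>" for y
  proof -
    let ?C = "principal_right_ideal R y"
    have yc: "y \<in> carrier R" using right_idealD(1)[OF B] y by auto
    then have "y \<in> ?C"
      by (auto simp: principal_right_ideal_def intro: image_eqI[where x = \<one>])
    moreover have "?C \<subseteq> B"
      using right_idealD(5)[OF B] y by (auto simp: principal_right_ideal_def)
    moreover have C: "right_ideal R ?C" using yc by (rule right_ideal_principal)
    ultimately have "A \<inter> ?C \<noteq> {\<zero>}"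
      using ess y(2) by (auto simp: essential_in_def)
    moreover have "\<zero> \<in> A \<inter> ?C" using right_idealD(2) A C by blast
    ultimately show ?thesis by (auto simp: principal_right_ideal_def)
  qed
  with A B AB show ?rhs by blast
next
  assume rhs: ?rhs
  have "A \<inter> C \<noteq> {\<zero>}" if C: "right_ideal R C" "C \<subseteq> B" "C \<noteq> {\<zero>}" for C
  proof -
    obtain y where y: "y \<in> C" "y \<noteq> \<zero>" using right_idealD(2)[OF C(1)] C(3) by blast
    then obtain r where "r \<in> carrier R" "y \<otimes> r \<in> A" "y \<otimes> r \<noteq> \<zero>" using rhs C(2) by blast
    then show ?thesis using right_idealD(5)[OF C(1) y(1)] by blast
  qed
  with rhs show ?lhs by (auto simp: essential_in_def)
qed

lemma minus_eq_zero_imp_eq: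
  assumes "x \<in> carrier R" and "y \<in> carrier R" and "x \<ominus> y = \<zero>"
  shows "x = y"
  using assms by (metis a_inv_closed a_minus_def minus_equality minus_minus)

text \<open>
  This is how nonsingularity is always used: if \<open>A\<close> is essential in \<open>B\<close> and \<open>y \<in> B\<close>, then the
  right ideal of all \<open>r\<close> with \<open>y r \<in> A\<close> is essential in the whole ring, so the only element it
  can annihilate is zero.
\<close>

lemma nonsingular_zeroI:
  assumes ns: "right_nonsingular R" and ess: "essential_in R A B"
    and y: "y \<in> B" and z: "z \<in> carrier R"
    and ann: "\<And>r. r \<in> carrier R \<Longrightarrow> y \<otimes> r \<in> A \<Longrightarrow> z \<otimes> r = \<zero>"
  shows "z = \<zero>"
proof (rule ccontr)
  assume "z \<noteq> \<zero>"
  have A: "right_ideal R A" and B: "right_ideal R B" using ess by (auto simp: essential_in_def)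
  have yc: "y \<in> carrier R" using right_idealD(1)[OF B] y by auto
  have "\<exists>r\<in>carrier R. w \<otimes> r \<in> right_annihilator R z \<and> w \<otimes> r \<noteq> \<zero>"
    if w: "w \<in> carrier R" "w \<noteq> \<zero>" for w
  proof (cases "y \<otimes> w = \<zero>")
    case True
    then have "z \<otimes> w = \<zero>" using ann w right_idealD(2)[OF A] by auto
    then show ?thesis using w by (intro bexI[of _ \<one>]) (auto simp: right_annihilator_def)
  next
    case False
    moreover have "y \<otimes> w \<in> B" using right_idealD(5)[OF B y] w by simp
    ultimately obtain r where r: "r \<in> carrier R" "y \<otimes> w \<otimes> r \<in> A" "y \<otimes> w \<otimes> r \<noteq> \<zero>"
      using ess by (auto simp: essential_in_iff)
    then have "y \<otimes> (w \<otimes> r) \<in> A" "y \<otimes> (w \<otimes> r) \<noteq> \<zero>" using yc w by (auto simp: m_assoc)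
    then show ?thesis
      using r(1) w ann[of "w \<otimes> r"] yc
      by (intro bexI[of _ r]) (auto simp: right_annihilator_def)
  qed
  then have "essential_in R (right_annihilator R z) (carrier R)"
    using right_ideal_right_annihilator[OF z] right_ideal_carrier right_idealD(1)
    unfolding essential_in_iff by blast
  with ns z \<open>z \<noteq> \<zero>\<close> show False by (auto simp: right_nonsingular_def)
qed


section \<open>Summands and annihilators in abelian rings\<close>

lemma idempotent_principal_right_ideal:
  assumes "idempotent R e"
  shows "principal_right_ideal R e = {x \<in> carrier R. e \<otimes> x = x}"
  using assms
  by (auto simp: idempotent_def principal_right_ideal_def m_assoc[symmetric] image_iff
      intro: sym)

text \<open>
  The generator is the component of \<open>1\<close> in the summand \<open>A\<close>: for \<open>x \<in> A\<close> the difference \<open>x - e x\<close>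
  lies both in \<open>A\<close> and in its complement.
\<close>

lemma direct_summand_idempotent:
  assumes "direct_summand R A"
  obtains e where "idempotent R e" and "A = principal_right_ideal R e"
proof -
  obtain B where A: "right_ideal R A" and B: "right_ideal R B"
    and AB: "A \<inter> B = {\<zero>}" "A <+> B = carrier R"
    using assms by (auto simp: direct_summand_def)
  have "\<one> \<in> A <+> B" using AB(2) by simp
  then obtain e f where ef: "e \<in> A" "f \<in> B" "\<one> = e \<oplus> f"
    by (auto simp: set_add_def')
  have c: "e \<in> carrier R" "f \<in> carrier R"
    using ef right_idealD(1) A B by blast+
  have fix_e: "e \<otimes> x = x" if x: "x \<in> A" for x
  proof -
    have xc: "x \<in> carrier R" using x right_idealD(1)[OF A] by blast
    have "x = e \<otimes> x \<oplus> f \<otimes> x" using ef(3) xc c l_distr[of e f x] by (metis l_one)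
    then have eq: "f \<otimes> x = x \<ominus> e \<otimes> x" using xc c
      by (metis a_comm a_minus_def add.inv_solve_right m_closed)
    have "f \<otimes> x \<in> B" using right_idealD(5)[OF B ef(2) xc] .
    moreover have "f \<otimes> x \<in> A"
      unfolding eq using right_idealD(4)[OF A x] right_idealD(5)[OF A ef(1) xc] by blast
    ultimately have "f \<otimes> x = \<zero>" using AB(1) by blast
    with \<open>x = e \<otimes> x \<oplus> f \<otimes> x\<close> show ?thesis using xc c by simp
  qed
  have idem: "idempotent R e" using fix_e[OF ef(1)] c by (simp add: idempotent_def)
  moreover have "A = principal_right_ideal R e"
  proof
    show "A \<subseteq> principal_right_ideal R e"
      using fix_e right_idealD(1)[OF A] idem by (auto simp: idempotent_principal_right_ideal)
    show "principal_right_ideal R e \<subseteq> A"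
      using right_idealD(5)[OF A ef(1)] by (auto simp: principal_right_ideal_def)
  qed
  ultimately show thesis by (rule that)
qed

lemma C1_essential_hull:
  assumes "right_C1 R" and "right_ideal R A"
  obtains e where "idempotent R e" and "essential_in R A (principal_right_ideal R e)"
  using assms direct_summand_idempotent unfolding right_C1_def by metis

lemma abelian_ringD:
  assumes "abelian_ring R" and "idempotent R e" and "x \<in> carrier R"
  shows "e \<otimes> x = x \<otimes> e"
  using assms unfolding abelian_ring_def by blast

text \<open>
  If \<open>a\<^sup>2 = 0\<close>, then \<open>a\<close> lies in its own right annihilator \<open>e R\<close>, whence \<open>a = e a = a e = 0\<close>.
  So the ring is reduced, and in a reduced ring \<open>a b = 0\<close> forces \<open>(b a)\<^sup>2 = 0\<close>; the left and right
  annihilators of an element therefore coincide.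
\<close>

lemma abelian_right_rickart_commute_zero:
  assumes ab: "abelian_ring R" and ri: "right_rickart R"
    and c: "a \<in> carrier R" "b \<in> carrier R" and ab0: "a \<otimes> b = \<zero>"
  shows "b \<otimes> a = \<zero>"
proof -
  have reduced: "x = \<zero>" if x: "x \<in> carrier R" and sq: "x \<otimes> x = \<zero>" for x
  proof -
    obtain e where e: "idempotent R e" "right_annihilator R x = principal_right_ideal R e"
      using ri x by (auto simp: right_rickart_def)
    have ec: "e \<in> carrier R" "e \<otimes> e = e" using e(1) by (auto simp: idempotent_def)
    have "x \<in> right_annihilator R x" using x sq by (simp add: right_annihilator_def)
    then have "e \<otimes> x = x" using e by (simp add: idempotent_principal_right_ideal)
    moreover have "e \<in> right_annihilator R x"
      using e ec by (simp add: idempotent_principal_right_ideal)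
    then have "x \<otimes> e = \<zero>" by (simp add: right_annihilator_def)
    ultimately show ?thesis using abelian_ringD[OF ab e(1) x] by simp
  qed
  have "(b \<otimes> a) \<otimes> (b \<otimes> a) = b \<otimes> (a \<otimes> b) \<otimes> a" using c by (simp add: m_assoc)
  also have "\<dots> = \<zero>" using c ab0 by simp
  finally show ?thesis using reduced c by blast
qed

lemma abelian_right_rickart_imp_rickart:
  assumes ab: "abelian_ring R" and ri: "right_rickart R"
  shows "rickart R"
proof -
  have "\<exists>e. idempotent R e \<and> left_annihilator R a = principal_left_ideal R e"
    if a: "a \<in> carrier R" for a
  proof -
    obtain e where e: "idempotent R e" "right_annihilator R a = principal_right_ideal R e"
      using ri a by (auto simp: right_rickart_def)
    have "left_annihilator R a = right_annihilator R a"
      using abelian_right_rickart_commute_zero[OF ab ri] a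
      by (auto simp: left_annihilator_def right_annihilator_def)
    moreover have "principal_left_ideal R e = principal_right_ideal R e"
      using abelian_ringD[OF ab e(1)]
      by (auto simp: principal_left_ideal_def principal_right_ideal_def image_iff)
    ultimately show ?thesis using e by auto
  qed
  with ri show ?thesis by (simp add: rickart_def left_rickart_def)
qed

text \<open>
  The annihilator of \<open>a\<close> is essential in some \<open>e R\<close>, and \<open>a e\<close> is annihilated by every \<open>r\<close> with
  \<open>e r\<close> in that annihilator; so \<open>a e = 0\<close> and the annihilator is all of \<open>e R\<close>.
\<close>

lemma nonsingular_C1_right_rickart:
  assumes ns: "right_nonsingular R" and C1: "right_C1 R"
  shows "right_rickart R"
  unfolding right_rickart_def
proof
  fix a assume a: "a \<in> carrier R"
  obtain e where e: "idempotent R e"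
    and ess: "essential_in R (right_annihilator R a) (principal_right_ideal R e)"
    using C1_essential_hull[OF C1 right_ideal_right_annihilator[OF a]] .
  have ec: "e \<in> carrier R" "e \<otimes> e = e" using e by (auto simp: idempotent_def)
  have "a \<otimes> e = \<zero>"
  proof (rule nonsingular_zeroI[OF ns ess])
    show "e \<in> principal_right_ideal R e" using ec e by (simp add: idempotent_principal_right_ideal)
    show "a \<otimes> e \<in> carrier R" using a ec by simp
    show "a \<otimes> e \<otimes> r = \<zero>" if "r \<in> carrier R" "e \<otimes> r \<in> right_annihilator R a" for r
      using that a ec by (simp add: right_annihilator_def m_assoc)
  qed
  then have "principal_right_ideal R e \<subseteq> right_annihilator R a"
    using a ec by (auto simp: principal_right_ideal_def right_annihilator_def m_assoc[symmetric])
  moreover have "right_annihilator R a \<subseteq> principal_right_ideal R e"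
    using ess by (simp add: essential_in_def)
  ultimately show "\<exists>e. idempotent R e \<and> right_annihilator R a = principal_right_ideal R e"
    using e by blast
qed

text \<open>
  An essential right ideal of the form \<open>e R\<close> is the whole ring, as it meets \<open>(1 - e) R\<close> in zero.
\<close>

lemma essential_idempotent_eq_one:
  assumes e: "idempotent R e" and ess: "essential_in R A (carrier R)"
    and A: "\<And>x. x \<in> A \<Longrightarrow> e \<otimes> x = x"
  shows "e = \<one>"
proof (rule ccontr)
  assume ne: "e \<noteq> \<one>"
  have ec: "e \<in> carrier R" "e \<otimes> e = e" using e by (auto simp: idempotent_def)
  have "\<one> \<ominus> e \<noteq> \<zero>" using ne ec by (metis one_closed minus_eq_zero_imp_eq)
  then obtain r where r: "r \<in> carrier R" "(\<one> \<ominus> e) \<otimes> r \<in> A" "(\<one> \<ominus> e) \<otimes> r \<noteq> \<zero>"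
    using ess ec unfolding essential_in_iff by (meson minus_closed one_closed)
  have "e \<otimes> (\<one> \<ominus> e) = \<zero>" using ec by (simp add: a_minus_def r_distr r_minus r_neg)
  then have "e \<otimes> ((\<one> \<ominus> e) \<otimes> r) = \<zero>" using ec r(1) by (simp add: m_assoc[symmetric])
  with A[OF r(2)] r(3) show False by simp
qed

lemma right_rickart_imp_nonsingular:
  assumes ri: "right_rickart R"
  shows "right_nonsingular R"
  unfolding right_nonsingular_def
proof (intro ballI impI notI)
  fix a assume a: "a \<in> carrier R" "a \<noteq> \<zero>"
    and ess: "essential_in R (right_annihilator R a) (carrier R)"
  obtain e where e: "idempotent R e" "right_annihilator R a = principal_right_ideal R e"
    using ri a by (auto simp: right_rickart_def)
  have "e = \<one>"
    by (rule essential_idempotent_eq_one[OF e(1) ess])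
      (simp add: e idempotent_principal_right_ideal)
  then have "\<one> \<in> right_annihilator R a" using e by (simp add: idempotent_principal_right_ideal)
  with a show False by (simp add: right_annihilator_def)
qed


section \<open>Special almost clean decompositions\<close>

text \<open>
  The idempotent \<open>e\<close> is central, so \<open>a e\<close> lies in \<open>a R \<inter> e R = 0\<close>.  Conversely, if \<open>a x = 0\<close>
  then the regular element \<open>a - e\<close> annihilates \<open>(1 - e) x\<close>, so that \<open>x = e x\<close>.
\<close>

lemma special_almost_clean_right_annihilator:
  assumes ab: "abelian_ring R" and a: "a \<in> carrier R"
    and d: "special_almost_clean_decomp R a u e"
  shows "right_annihilator R a = principal_right_ideal R e"
proof -
  have e: "idempotent R e" and u: "regular_element R u" and aue: "a = u \<oplus> e"
    and int: "principal_right_ideal R a \<inter> principal_right_ideal R e = {\<zero>}"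
    using d by (auto simp: special_almost_clean_decomp_def)
  have ec: "e \<in> carrier R" "e \<otimes> e = e" and uc: "u \<in> carrier R"
    using e u by (auto simp: idempotent_def regular_element_def)
  have "a \<otimes> e \<in> principal_right_ideal R a"
    using ec by (auto simp: principal_right_ideal_def)
  moreover have "a \<otimes> e \<in> principal_right_ideal R e"
    using abelian_ringD[OF ab e a, symmetric] a by (auto simp: principal_right_ideal_def)
  ultimately have ae: "a \<otimes> e = \<zero>" using int by blast
  have "e \<otimes> x = x" if x: "x \<in> carrier R" "a \<otimes> x = \<zero>" for x
  proof -
    have "u = a \<ominus> e" using aue uc ec by (simp add: a_minus_def a_assoc r_neg)
    moreover have "a \<otimes> (x \<ominus> e \<otimes> x) = \<zero>"
      using x a ec ae by (simp add: a_minus_def r_distr r_minus m_assoc[symmetric])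
    moreover have "e \<otimes> (x \<ominus> e \<otimes> x) = \<zero>"
      using x ec by (simp add: a_minus_def r_distr r_minus m_assoc[symmetric] r_neg)
    ultimately have "u \<otimes> (x \<ominus> e \<otimes> x) = \<zero>"
      using x a ec by (simp add: a_minus_def l_distr l_minus)
    then have "x \<ominus> e \<otimes> x = \<zero>"
      using u x ec by (auto simp: regular_element_def left_zero_divisor_def)
    then show ?thesis using x ec by (metis m_closed minus_eq_zero_imp_eq)
  qed
  moreover have "a \<otimes> x = \<zero>" if "x \<in> carrier R" "e \<otimes> x = x" for x
    using that ae a ec by (metis l_null m_assoc)
  ultimately show ?thesis
    by (auto simp: right_annihilator_def idempotent_principal_right_ideal[OF e])
qed

text \<open>
  The right annihilator determines \<open>e\<close>, because two central idempotents that generate the same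
  right ideal are equal.
\<close>

lemma special_almost_clean_unique:
  assumes ab: "abelian_ring R" and a: "a \<in> carrier R"
    and d: "special_almost_clean_decomp R a u e" and d': "special_almost_clean_decomp R a u' e'"
  shows "u = u' \<and> e = e'"
proof -
  have e: "idempotent R e" "idempotent R e'"
    and c: "u \<in> carrier R" "u' \<in> carrier R" "e \<in> carrier R" "e' \<in> carrier R"
    and s: "a = u \<oplus> e" "a = u' \<oplus> e'" and sq: "e \<otimes> e = e" "e' \<otimes> e' = e'"
    using d d' by (auto simp: special_almost_clean_decomp_def regular_element_def idempotent_def)
  have "principal_right_ideal R e = principal_right_ideal R e'"
    using special_almost_clean_right_annihilator[OF ab a d]
      special_almost_clean_right_annihilator[OF ab a d'] by simp
  then have "{x \<in> carrier R. e \<otimes> x = x} = {x \<in> carrier R. e' \<otimes> x = x}"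
    using e by (simp add: idempotent_principal_right_ideal)
  then have "e' \<otimes> e = e" "e \<otimes> e' = e'" using c sq by blast+
  then have "e = e'" using abelian_ringD[OF ab e(1) c(4)] by simp
  then show ?thesis using s c by (metis add.right_cancel)
qed

text \<open>
  Let \<open>e R\<close> be the right annihilator of \<open>a\<close>, so that \<open>a e = e a = 0\<close>.  If \<open>(a - e) x = 0\<close>, then
  \<open>a x = e x\<close>; multiplication by \<open>e\<close> gives \<open>e x = 0\<close>, whence \<open>a x = 0\<close>, and so \<open>x = e x = 0\<close>.
  Left multiples of \<open>a - e\<close> need no separate argument, because the ring is reduced.
\<close>

lemma rickart_special_almost_clean:
  assumes ab: "abelian_ring R" and ri: "right_rickart R" and a: "a \<in> carrier R"
  obtains u e where "special_almost_clean_decomp R a u e"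
proof -
  obtain e where e: "idempotent R e" "right_annihilator R a = principal_right_ideal R e"
    using ri a by (auto simp: right_rickart_def)
  have ec: "e \<in> carrier R" "e \<otimes> e = e" using e(1) by (auto simp: idempotent_def)
  have iff: "a \<otimes> x = \<zero> \<longleftrightarrow> e \<otimes> x = x" if "x \<in> carrier R" for x
    using e that by (auto simp: idempotent_principal_right_ideal right_annihilator_def)
  have ae: "a \<otimes> e = \<zero>" using iff ec by simp
  have ea: "e \<otimes> a = \<zero>" using abelian_ringD[OF ab e(1) a] ae by simp
  let ?u = "a \<ominus> e"
  have uc: "?u \<in> carrier R" using a ec by simp
  have left: "x = \<zero>" if x: "x \<in> carrier R" "?u \<otimes> x = \<zero>" for x
  proof -
    have "a \<otimes> x \<ominus> e \<otimes> x = \<zero>" using x a ec by (simp add: a_minus_def l_distr l_minus)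
    then have eq: "a \<otimes> x = e \<otimes> x" using x a ec by (metis m_closed minus_eq_zero_imp_eq)
    have "e \<otimes> x = e \<otimes> (e \<otimes> x)" using ec x by (simp add: m_assoc[symmetric])
    also have "\<dots> = e \<otimes> a \<otimes> x" using eq[symmetric] ec x a by (simp add: m_assoc)
    also have "\<dots> = \<zero>" using ea x by simp
    finally show ?thesis using eq iff[OF x(1)] by simp
  qed
  have "regular_element R ?u"
  proof -
    have "x = \<zero>" if "x \<in> carrier R" "x \<otimes> ?u = \<zero>" for x
      using abelian_right_rickart_commute_zero[OF ab ri that(1) uc that(2)] left that(1) by blast
    then show ?thesis
      using left uc
      unfolding regular_element_def left_zero_divisor_def right_zero_divisor_def by blast
  qed
  moreover have "a = ?u \<oplus> e" using a ec by (simp add: a_minus_def a_assoc l_neg)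
  moreover have "principal_right_ideal R a \<inter> principal_right_ideal R e = {\<zero>}"
  proof -
    have "y = \<zero>" if y: "y \<in> principal_right_ideal R a" "y \<in> principal_right_ideal R e" for y
    proof -
      obtain r where r: "r \<in> carrier R" "y = a \<otimes> r"
        using y(1) by (auto simp: principal_right_ideal_def)
      have "y = e \<otimes> y" using y(2) e(1) by (simp add: idempotent_principal_right_ideal)
      also have "\<dots> = e \<otimes> a \<otimes> r" using r a ec(1) by (simp add: m_assoc)
      also have "\<dots> = \<zero>" using ea r(1) by simp
      finally show ?thesis .
    qed
    moreover have "\<zero> \<in> principal_right_ideal R a" "\<zero> \<in> principal_right_ideal R e"
      using right_idealD(2)[OF right_ideal_principal] a ec(1) by auto
    ultimately show ?thesis by blast
  qed
  ultimately have "special_almost_clean_decomp R a ?u e"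
    using e(1) unfolding special_almost_clean_decomp_def by blast
  then show thesis by (rule that)
qed

lemma uniquely_special_almost_clean_iff_right_rickart:
  assumes ab: "abelian_ring R"
  shows "uniquely_special_almost_clean R \<longleftrightarrow> right_rickart R"
proof
  assume "uniquely_special_almost_clean R"
  then have "\<exists>u e. special_almost_clean_decomp R a u e" if "a \<in> carrier R" for a
    using that unfolding uniquely_special_almost_clean_def by blast
  then show "right_rickart R"
    using special_almost_clean_right_annihilator[OF ab]
    unfolding right_rickart_def special_almost_clean_decomp_def by metis
next
  assume ri: "right_rickart R"
  show "uniquely_special_almost_clean R"
    unfolding uniquely_special_almost_clean_def
  proof
    fix a assume a: "a \<in> carrier R"
    obtain u e where d: "special_almost_clean_decomp R a u e"
      using rickart_special_almost_clean[OF ab ri a] .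
    show "\<exists>!(u, e). special_almost_clean_decomp R a u e"
      by (rule ex1I[of _ "(u, e)"]) (use d special_almost_clean_unique[OF ab a] in auto)
  qed
qed


section \<open>Dense right ideals and partial homomorphisms\<close>

lemma dense_right_idealD:
  assumes "dense_right_ideal R D"
  shows "right_ideal R D"
    and "\<And>x y. x \<in> carrier R \<Longrightarrow> y \<in> carrier R \<Longrightarrow> x \<noteq> \<zero> \<Longrightarrow>
      \<exists>r\<in>carrier R. x \<otimes> r \<noteq> \<zero> \<and> y \<otimes> r \<in> D"
  using assms by (auto simp: dense_right_ideal_def)

lemma dense_carrier: "dense_right_ideal R (carrier R)"
  unfolding dense_right_ideal_def
  by (auto simp: right_ideal_carrier intro!: bexI[of _ \<one>])

lemma dense_homsD:
  assumes "(D, f) \<in> dense_homs R"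
  shows "dense_right_ideal R D" and "right_ideal R D" and "f \<in> extensional D"
    and "\<And>x. x \<in> D \<Longrightarrow> f x \<in> carrier R"
    and "\<And>x y. x \<in> D \<Longrightarrow> y \<in> D \<Longrightarrow> f (x \<oplus> y) = f x \<oplus> f y"
    and "\<And>x r. x \<in> D \<Longrightarrow> r \<in> carrier R \<Longrightarrow> f (x \<otimes> r) = f x \<otimes> r"
    and "f \<zero> = \<zero>"
    and "\<And>x y. x \<in> D \<Longrightarrow> y \<in> D \<Longrightarrow> f (x \<ominus> y) = f x \<ominus> f y"
proof -
  show d: "dense_right_ideal R D"
    and "f \<in> extensional D"
    and c: "\<And>x. x \<in> D \<Longrightarrow> f x \<in> carrier R"
    and add: "\<And>x y. x \<in> D \<Longrightarrow> y \<in> D \<Longrightarrow> f (x \<oplus> y) = f x \<oplus> f y"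
    and mul: "\<And>x r. x \<in> D \<Longrightarrow> r \<in> carrier R \<Longrightarrow> f (x \<otimes> r) = f x \<otimes> r"
    using assms by (auto simp: dense_homs_def PiE_def)
  show D: "right_ideal R D" using d by (rule dense_right_idealD)
  show zero: "f \<zero> = \<zero>"
    using mul[of \<zero> \<zero>] c[of \<zero>] right_idealD(2)[OF D] by simp
  fix x y assume xy: "x \<in> D" "y \<in> D"
  have xyc: "x \<in> carrier R" "y \<in> carrier R" using xy right_idealD(1)[OF D] by auto
  have "f (x \<ominus> y) \<oplus> f y = f (x \<ominus> y \<oplus> y)" using add right_idealD(4)[OF D] xy by simp
  also have "x \<ominus> y \<oplus> y = x" using xyc by (simp add: a_minus_def a_assoc l_neg)
  finally show "f (x \<ominus> y) = f x \<ominus> f y"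
    using c xy right_idealD(4)[OF D]
    by (metis a_minus_def add.inv_solve_right)
qed

lemma dense_homsI:
  assumes "dense_right_ideal R D"
    and "\<And>x. x \<in> D \<Longrightarrow> f x \<in> carrier R"
    and "\<And>x y. x \<in> D \<Longrightarrow> y \<in> D \<Longrightarrow> f (x \<oplus> y) = f x \<oplus> f y"
    and "\<And>x r. x \<in> D \<Longrightarrow> r \<in> carrier R \<Longrightarrow> f (x \<otimes> r) = f x \<otimes> r"
  shows "(D, restrict f D) \<in> dense_homs R"
  using assms right_idealD(3,5)[OF dense_right_idealD(1)[OF assms(1)]]
  by (auto simp: dense_homs_def)

text \<open>
  Density is tested on a pair \<open>(x, y)\<close>: one multiplier brings \<open>y\<close> into \<open>E\<close>, and a second one then
  brings its image into \<open>D\<close>, without killing \<open>x\<close>.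
\<close>

lemma dense_preimage:
  assumes D: "dense_right_ideal R D" and E: "dense_right_ideal R E"
    and c: "\<And>x. x \<in> E \<Longrightarrow> g x \<in> carrier R"
    and add: "\<And>x y. x \<in> E \<Longrightarrow> y \<in> E \<Longrightarrow> g (x \<oplus> y) = g x \<oplus> g y"
    and mul: "\<And>x r. x \<in> E \<Longrightarrow> r \<in> carrier R \<Longrightarrow> g (x \<otimes> r) = g x \<otimes> r"
  shows "dense_right_ideal R {x \<in> E. g x \<in> D}"
proof -
  note D' = dense_right_idealD[OF D] and E' = dense_right_idealD[OF E]
  note rD = right_idealD[OF D'(1)] and rE = right_idealD[OF E'(1)]
  have "g \<zero> = \<zero>" using mul[of \<zero> \<zero>] c[of \<zero>] rE(2) by simp
  then have "right_ideal R {x \<in> E. g x \<in> D}"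
    using rD rE add mul by (intro right_idealI) auto
  moreover have "\<exists>r\<in>carrier R. x \<otimes> r \<noteq> \<zero> \<and> y \<otimes> r \<in> {x \<in> E. g x \<in> D}"
    if xy: "x \<in> carrier R" "y \<in> carrier R" "x \<noteq> \<zero>" for x y
  proof -
    obtain r where r: "r \<in> carrier R" "x \<otimes> r \<noteq> \<zero>" "y \<otimes> r \<in> E" using E'(2) xy by blast
    obtain s where s: "s \<in> carrier R" "x \<otimes> r \<otimes> s \<noteq> \<zero>" "g (y \<otimes> r) \<otimes> s \<in> D"
      using D'(2)[of "x \<otimes> r" "g (y \<otimes> r)"] xy r c by auto
    show ?thesis
      using r s xy rE(5)[OF r(3) s(1)] mul[OF r(3) s(1)]
      by (intro bexI[of _ "r \<otimes> s"]) (auto simp: m_assoc)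
  qed
  ultimately show ?thesis by (auto simp: dense_right_ideal_def)
qed

lemma dense_Int:
  assumes "dense_right_ideal R D" and "dense_right_ideal R E"
  shows "dense_right_ideal R (D \<inter> E)"
proof -
  have "dense_right_ideal R {x \<in> E. x \<in> D}"
    using right_idealD(1)[OF dense_right_idealD(1)[OF assms(2)]]
    by (intro dense_preimage assms) auto
  moreover have "{x \<in> E. x \<in> D} = D \<inter> E" by blast
  ultimately show ?thesis by simp
qed

lemma equiv_dense_hom_rel: "equiv (dense_homs R) (dense_hom_rel R)"
proof (rule equivI)
  show "dense_hom_rel R \<subseteq> dense_homs R \<times> dense_homs R"
    by (auto simp: dense_hom_rel_def)
  show "refl_on (dense_homs R) (dense_hom_rel R)"
    unfolding refl_on_def using dense_homsD(1) by (auto simp: dense_hom_rel_def)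
  show "sym (dense_hom_rel R)"
    unfolding sym_def dense_hom_rel_def by clarsimp (metis Int_commute le_inf_iff)
  show "trans (dense_hom_rel R)"
  proof (rule transI)
    fix p q s assume pq: "(p, q) \<in> dense_hom_rel R" and qs: "(q, s) \<in> dense_hom_rel R"
    obtain D f E g F k where [simp]: "p = (D, f)" "q = (E, g)" "s = (F, k)"
      by (metis surj_pair)
    obtain H where H: "dense_right_ideal R H" "H \<subseteq> D \<inter> E" "\<forall>x\<in>H. f x = g x"
      using pq by (auto simp: dense_hom_rel_def)
    obtain K where K: "dense_right_ideal R K" "K \<subseteq> E \<inter> F" "\<forall>x\<in>K. g x = k x"
      using qs by (auto simp: dense_hom_rel_def)
    have "dense_right_ideal R (H \<inter> K)" "H \<inter> K \<subseteq> D \<inter> F" "\<forall>x\<in>H \<inter> K. f x = k x"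
      using H K dense_Int by auto
    then show "(p, s) \<in> dense_hom_rel R" using pq qs by (auto simp: dense_hom_rel_def)
  qed
qed

lemma dense_hom_comp:
  assumes Df: "(D, f) \<in> dense_homs R" and Eg: "(E, g) \<in> dense_homs R"
  defines "P \<equiv> {x \<in> E. g x \<in> D}"
  shows "(P, restrict (\<lambda>x. f (g x)) P) \<in> dense_homs R"
proof (rule dense_homsI)
  show "dense_right_ideal R P"
    unfolding P_def by (rule dense_preimage) (use dense_homsD[OF Df] dense_homsD[OF Eg] in auto)
qed (use dense_homsD[OF Df] dense_homsD[OF Eg] in \<open>auto simp: P_def\<close>)

text \<open>
  Composition of partial homomorphisms respects the identification of pairs: if \<open>f\<close> and \<open>f'\<close> agree
  on \<open>H\<close> and \<open>g\<close> and \<open>g'\<close> agree on \<open>K\<close>, the composites agree on the dense set of \<open>x \<in> K\<close> with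
  \<open>g x \<in> H\<close>.
\<close>

lemma dense_hom_class_comp_cong:
  assumes f: "((D, f), (D', f')) \<in> dense_hom_rel R" and g: "((E, g), (E', g')) \<in> dense_hom_rel R"
  shows "dense_hom_class R {x \<in> E'. g' x \<in> D'} (\<lambda>x. f' (g' x)) =
    dense_hom_class R {x \<in> E. g x \<in> D} (\<lambda>x. f (g x))"
proof -
  obtain H where H: "dense_right_ideal R H" "H \<subseteq> D \<inter> D'" "\<forall>x\<in>H. f x = f' x"
    using f by (auto simp: dense_hom_rel_def)
  obtain K where K: "dense_right_ideal R K" "K \<subseteq> E \<inter> E'" "\<forall>x\<in>K. g x = g' x"
    using g by (auto simp: dense_hom_rel_def)
  have homs: "(D, f) \<in> dense_homs R" "(D', f') \<in> dense_homs R"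
    "(E, g) \<in> dense_homs R" "(E', g') \<in> dense_homs R"
    using f g by (auto simp: dense_hom_rel_def)
  have "x \<in> E" if "x \<in> K" for x using K(2) that by blast
  then have dense: "dense_right_ideal R {x \<in> K. g x \<in> H}"
    by (intro dense_preimage[OF H(1) K(1)]) (use dense_homsD(4-6)[OF homs(3)] in auto)
  have "\<forall>x\<in>{x \<in> K. g x \<in> H}. restrict (\<lambda>x. f (g x)) {x \<in> E. g x \<in> D} x =
      restrict (\<lambda>x. f' (g' x)) {x \<in> E'. g' x \<in> D'} x"
    using H K by (auto simp: restrict_def subset_iff)
  moreover have "{x \<in> K. g x \<in> H} \<subseteq> {x \<in> E. g x \<in> D} \<inter> {x \<in> E'. g' x \<in> D'}"
    using H K by auto
  ultimately have "(({x \<in> E. g x \<in> D}, restrict (\<lambda>x. f (g x)) {x \<in> E. g x \<in> D}),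
      ({x \<in> E'. g' x \<in> D'}, restrict (\<lambda>x. f' (g' x)) {x \<in> E'. g' x \<in> D'})) \<in> dense_hom_rel R"
    using dense homs dense_hom_comp unfolding dense_hom_rel_def by blast
  then show ?thesis
    unfolding dense_hom_class_def by (rule equiv_class_eq[OF equiv_dense_hom_rel, symmetric])
qed

lemma dense_hom_class_restrict:
  assumes "(D, f) \<in> dense_homs R"
  shows "dense_hom_class R D f = dense_hom_rel R `` {(D, f)}"
  using dense_homsD(3)[OF assms] by (simp add: dense_hom_class_def extensional_restrict)

lemma mult_dense_hom_class:
  assumes Df: "(D, f) \<in> dense_homs R" and Eg: "(E, g) \<in> dense_homs R"
  shows "dense_hom_class R D f \<otimes>\<^bsub>max_right_quotient_ring R\<^esub> dense_hom_class R E g =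
    dense_hom_class R {x \<in> E. g x \<in> D} (\<lambda>x. f (g x))" (is "_ = ?C")
proof -
  have "(\<Union>(D, f)\<in>dense_hom_rel R `` {(D, f)}. \<Union>(E, g)\<in>dense_hom_rel R `` {(E, g)}.
      dense_hom_class R {x \<in> E. g x \<in> D} (\<lambda>x. f (g x))) =
    (\<Union>p\<in>dense_hom_rel R `` {(D, f)}. \<Union>q\<in>dense_hom_rel R `` {(E, g)}.
      dense_hom_class R {x \<in> fst q. snd q x \<in> fst p} (\<lambda>x. snd p (snd q x)))"
    by (simp add: split_def)
  also have "\<dots> = (\<Union>p\<in>dense_hom_rel R `` {(D, f)}. \<Union>q\<in>dense_hom_rel R `` {(E, g)}. ?C)"
    by (intro SUP_cong refl dense_hom_class_comp_cong) auto
  also have "\<dots> = ?C"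
    using equiv_class_self[OF equiv_dense_hom_rel Df] equiv_class_self[OF equiv_dense_hom_rel Eg]
    by auto
  finally show ?thesis
    by (simp add: max_right_quotient_ring_def dense_hom_class_restrict Df Eg)
qed

lemma dense_hom_class_in_carrier:
  assumes "(D, f) \<in> dense_homs R"
  shows "dense_hom_class R D f \<in> carrier (max_right_quotient_ring R)"
  using assms by (auto simp: max_right_quotient_ring_def dense_hom_class_restrict intro: quotientI)

lemma carrier_max_right_quotient_ringE:
  assumes "q \<in> carrier (max_right_quotient_ring R)"
  obtains D f where "(D, f) \<in> dense_homs R" and "q = dense_hom_class R D f"
  using assms
  by (auto simp: max_right_quotient_ring_def dense_hom_class_restrict elim!: quotientE)

lemma dense_hom_class_eq_iff:
  assumes "(D, f) \<in> dense_homs R" and "(E, g) \<in> dense_homs R"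
  shows "dense_hom_class R D f = dense_hom_class R E g \<longleftrightarrow>
    (\<exists>H. dense_right_ideal R H \<and> H \<subseteq> D \<inter> E \<and> (\<forall>x\<in>H. f x = g x))"
  using assms
  by (simp add: dense_hom_class_restrict eq_equiv_class_iff[OF equiv_dense_hom_rel])
    (simp add: dense_hom_rel_def)

lemma dense_hom_class_restrict_fun:
  "dense_hom_class R D (restrict f D) = dense_hom_class R D f"
  by (simp add: dense_hom_class_def)

text \<open>
  This brings the equation \<open>q = q r q\<close> in the quotient ring down to representatives; both
  directions of the regularity criterion below use it.
\<close>

lemma dense_hom_class_quasi_inverse_iff:
  assumes Df: "(D, f) \<in> dense_homs R" and Ep: "(E, p) \<in> dense_homs R"
  shows "dense_hom_class R D f = dense_hom_class R D f \<otimes>\<^bsub>max_right_quotient_ring R\<^esub>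
      dense_hom_class R E p \<otimes>\<^bsub>max_right_quotient_ring R\<^esub> dense_hom_class R D f \<longleftrightarrow>
    (\<exists>H. dense_right_ideal R H \<and> H \<subseteq> {x \<in> D. f x \<in> E \<and> p (f x) \<in> D} \<and>
      (\<forall>x\<in>H. f (p (f x)) = f x))"
proof -
  define P where "P = {x \<in> E. p x \<in> D}"
  define k where "k = restrict (\<lambda>x. f (p x)) P"
  have k: "(P, k) \<in> dense_homs R"
    unfolding P_def k_def by (rule dense_hom_comp[OF Df Ep])
  define P' where "P' = {x \<in> D. f x \<in> P}"
  define k' where "k' = restrict (\<lambda>x. k (f x)) P'"
  have k': "(P', k') \<in> dense_homs R"
    unfolding P'_def k'_def by (rule dense_hom_comp[OF k Df])
  have "dense_hom_class R D f \<otimes>\<^bsub>max_right_quotient_ring R\<^esub> dense_hom_class R E p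
      = dense_hom_class R P k"
    unfolding mult_dense_hom_class[OF Df Ep] k_def P_def dense_hom_class_restrict_fun ..
  moreover have "dense_hom_class R P k \<otimes>\<^bsub>max_right_quotient_ring R\<^esub> dense_hom_class R D f
      = dense_hom_class R P' k'"
    unfolding mult_dense_hom_class[OF k Df] k'_def P'_def dense_hom_class_restrict_fun ..
  moreover have "P' = {x \<in> D. f x \<in> E \<and> p (f x) \<in> D}" by (simp add: P'_def P_def)
  moreover have "k' x = f (p (f x))" if "x \<in> P'" for x
    using that by (simp add: k'_def k_def P'_def)
  moreover have "P' \<subseteq> D" by (auto simp: P'_def)
  ultimately show ?thesis
    using dense_hom_class_eq_iff[OF Df k'] by (smt (verit) Int_absorb1 subsetD)
qed

lemma one_max_right_quotient_ring:
  "\<one>\<^bsub>max_right_quotient_ring R\<^esub> = dense_hom_class R (carrier R) (\<lambda>x. x)"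
  by (simp add: max_right_quotient_ring_def)


section \<open>Regularity of the maximal right ring of quotients\<close>

text \<open>
  Write \<open>a = a q a\<close> with \<open>q\<close> represented by \<open>f : D \<rightarrow> R\<close>, so that \<open>a f(a x) = a x\<close> on a dense
  right ideal.  Were some \<open>y = f(a x)\<close> nonzero, essentiality of the annihilator of \<open>a\<close> would give
  \<open>s\<close> with \<open>y s \<noteq> 0\<close> and \<open>a y s = 0\<close>; but then \<open>a x s = a y s = 0\<close> and \<open>y s = f(a x s) = 0\<close>.
  Hence \<open>a\<close> vanishes on a dense right ideal, that is, \<open>a = 0\<close>.
\<close>

lemma unit_regular_quotient_imp_nonsingular:
  assumes ur: "unit_regular (max_right_quotient_ring R)"
  shows "right_nonsingular R"
  unfolding right_nonsingular_def
proof (intro ballI impI notI)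
  fix a assume a: "a \<in> carrier R" "a \<noteq> \<zero>"
    and ess: "essential_in R (right_annihilator R a) (carrier R)"
  let ?Q = "max_right_quotient_ring R"
  define l where "l = restrict (\<lambda>x. a \<otimes> x) (carrier R)"
  have l: "(carrier R, l) \<in> dense_homs R"
    unfolding l_def using a by (intro dense_homsI dense_carrier) (auto simp: r_distr m_assoc)
  have lx: "l x = a \<otimes> x" if "x \<in> carrier R" for x using that by (simp add: l_def)
  define q0 where "q0 = dense_hom_class R (carrier R) l"
  have "q0 \<in> carrier ?Q" unfolding q0_def by (rule dense_hom_class_in_carrier[OF l])
  then obtain q where q: "q \<in> carrier ?Q" "q0 = q0 \<otimes>\<^bsub>?Q\<^esub> q \<otimes>\<^bsub>?Q\<^esub> q0"
    using ur unfolding unit_regular_def Units_def by blast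
  obtain D f where Df: "(D, f) \<in> dense_homs R" and qDf: "q = dense_hom_class R D f"
    using carrier_max_right_quotient_ringE[OF q(1)] .
  note f = dense_homsD[OF Df]
  obtain H where H: "dense_right_ideal R H"
    "H \<subseteq> {x \<in> carrier R. l x \<in> D \<and> f (l x) \<in> carrier R}" "\<forall>x\<in>H. l (f (l x)) = l x"
    using q(2) unfolding q0_def qDf dense_hom_class_quasi_inverse_iff[OF l Df] by blast
  have HD: "x \<in> carrier R" "a \<otimes> x \<in> D" "a \<otimes> f (a \<otimes> x) = a \<otimes> x" if "x \<in> H" for x
  proof -
    show "x \<in> carrier R" using H(2) that by blast
    then have eq: "l x = a \<otimes> x" by (rule lx)
    have "l x \<in> D" "f (l x) \<in> carrier R" "l (f (l x)) = l x" using H(2,3) that by auto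
    then show "a \<otimes> x \<in> D" "a \<otimes> f (a \<otimes> x) = a \<otimes> x" by (simp_all add: eq lx)
  qed
  have "a \<otimes> x = \<zero>" if x: "x \<in> H" for x
  proof (rule ccontr)
    assume nz: "a \<otimes> x \<noteq> \<zero>"
    let ?y = "f (a \<otimes> x)"
    have y: "?y \<in> carrier R" using f(4) HD(2)[OF x] .
    have "?y \<noteq> \<zero>" using nz HD(3)[OF x] a by auto
    then obtain s where s: "s \<in> carrier R" "?y \<otimes> s \<in> right_annihilator R a" "?y \<otimes> s \<noteq> \<zero>"
      using ess y unfolding essential_in_iff by blast
    have "a \<otimes> x \<otimes> s = a \<otimes> (?y \<otimes> s)"
      using HD(3)[OF x] a y s(1) by (simp add: m_assoc[symmetric])
    also have "\<dots> = \<zero>" using s(2) by (simp add: right_annihilator_def)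
    finally have "f (a \<otimes> x \<otimes> s) = \<zero>" using f(7) by simp
    with f(6)[OF HD(2)[OF x] s(1)] s(3) show False by simp
  qed
  moreover obtain r where "r \<in> carrier R" "a \<otimes> r \<noteq> \<zero>" "\<one> \<otimes> r \<in> H"
    using dense_right_idealD(2)[OF H(1) a(1) one_closed a(2)] by blast
  ultimately show False by simp
qed

lemma dense_imp_essential:
  assumes "dense_right_ideal R D"
  shows "essential_in R D (carrier R)"
  unfolding essential_in_iff
proof (intro conjI ballI impI)
  show D: "right_ideal R D" using assms by (rule dense_right_idealD(1))
  show "D \<subseteq> carrier R" using D by (rule right_idealD(1))
  fix y assume "y \<in> carrier R" "y \<noteq> \<zero>"
  then show "\<exists>r\<in>carrier R. y \<otimes> r \<in> D \<and> y \<otimes> r \<noteq> \<zero>"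
    using dense_right_idealD(2)[OF assms, of y y] by blast
qed (rule right_ideal_carrier)

text \<open>
  For the pair \<open>(x, y)\<close> of the density test, a failure would mean that \<open>x\<close> kills every \<open>r\<close> with
  \<open>y r \<in> D\<close>.
\<close>

lemma nonsingular_essential_imp_dense:
  assumes ns: "right_nonsingular R" and ess: "essential_in R D (carrier R)"
  shows "dense_right_ideal R D"
  unfolding dense_right_ideal_def
proof (intro conjI ballI impI)
  show "right_ideal R D" using ess by (simp add: essential_in_def)
  fix x y assume "x \<in> carrier R" "y \<in> carrier R" "x \<noteq> \<zero>"
  then show "\<exists>r\<in>carrier R. x \<otimes> r \<noteq> \<zero> \<and> y \<otimes> r \<in> D"
    using nonsingular_zeroI[OF ns ess, of y x] by blast
qed

text \<open>
  The image of \<open>h\<close> is essential in some \<open>g R\<close> with \<open>g\<close> central.  Then \<open>h x = h(x) g = h(x g)\<close>, and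
  injectivity gives \<open>x = x g\<close> on all of \<open>D\<close>; as \<open>D\<close> is essential, \<open>g = 1\<close>.
\<close>

lemma injective_dense_hom_image_essential:
  assumes ab: "abelian_ring R" and C1: "right_C1 R"
    and Dh: "(D, h) \<in> dense_homs R" and inj: "inj_on h D"
  shows "essential_in R (h ` D) (carrier R)"
proof -
  note h = dense_homsD[OF Dh]
  note D = right_idealD[OF h(2)]
  have "right_ideal R (h ` D)"
  proof (rule right_idealI)
    show "\<zero> \<in> h ` D" using h(7) D(2) by (metis imageI)
    show "x \<oplus> y \<in> h ` D" if "x \<in> h ` D" "y \<in> h ` D" for x y
      using that h(5) D(3) by (metis (no_types, lifting) imageE imageI)
    show "x \<otimes> r \<in> h ` D" if "x \<in> h ` D" "r \<in> carrier R" for x r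
      using that h(6) D(5) by (metis (no_types, lifting) imageE imageI)
  qed (use h(4) in auto)
  then obtain g where g: "idempotent R g" and ess: "essential_in R (h ` D) (principal_right_ideal R g)"
    using C1_essential_hull[OF C1] by blast
  have gc: "g \<in> carrier R" using g by (simp add: idempotent_def)
  have "g \<otimes> x = x" if x: "x \<in> D" for x
  proof -
    have "g \<otimes> h x = h x"
      using ess x g by (auto simp: essential_in_def idempotent_principal_right_ideal)
    then have "h (x \<otimes> g) = h x" using abelian_ringD[OF ab g h(4)[OF x]] h(6)[OF x gc] by simp
    then have "x \<otimes> g = x" using inj x D(5)[OF x gc] by (simp add: inj_on_eq_iff)
    then show ?thesis using abelian_ringD[OF ab g] x D(1) by auto
  qed
  then have "g = \<one>"
    using essential_idempotent_eq_one[OF g dense_imp_essential[OF h(1)]] by blast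
  moreover have "principal_right_ideal R \<one> = carrier R"
    by (auto simp: principal_right_ideal_def image_iff)
  ultimately show ?thesis using ess by simp
qed

text \<open>
  The inverse of \<open>h\<close> is a partial homomorphism on the image of \<open>h\<close>, so it lives in the quotient
  ring as soon as this image is dense.
\<close>

lemma injective_dense_hom_unit:
  assumes Dh: "(D, h) \<in> dense_homs R" and inj: "inj_on h D"
    and dense: "dense_right_ideal R (h ` D)"
  defines "p \<equiv> restrict (inv_into D h) (h ` D)"
  shows "(h ` D, p) \<in> dense_homs R"
    and "dense_hom_class R (h ` D) p \<in> Units (max_right_quotient_ring R)"
proof -
  note h = dense_homsD[OF Dh]
  note D = right_idealD[OF h(2)]
  have ph: "p (h x) = x" if "x \<in> D" for x using that inj by (simp add: p_def)
  have hp: "p y \<in> D" "h (p y) = y" if "y \<in> h ` D" for y using that ph by auto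
  have "(h ` D, restrict p (h ` D)) \<in> dense_homs R"
  proof (rule dense_homsI[OF dense])
    show "p y \<in> carrier R" if "y \<in> h ` D" for y using hp(1)[OF that] D(1) by blast
    show "p (y \<oplus> z) = p y \<oplus> p z" if "y \<in> h ` D" "z \<in> h ` D" for y z
      using ph[OF D(3)[OF hp(1)[OF that(1)] hp(1)[OF that(2)]]] hp that h(5) by simp
    show "p (y \<otimes> r) = p y \<otimes> r" if "y \<in> h ` D" "r \<in> carrier R" for y r
      using ph[OF D(5)[OF hp(1)[OF that(1)] that(2)]] hp that h(6) by simp
  qed
  then show P: "(h ` D, p) \<in> dense_homs R" by (simp add: p_def)
  let ?Q = "max_right_quotient_ring R"
  have id: "(carrier R, restrict (\<lambda>x. x) (carrier R)) \<in> dense_homs R"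
    by (rule dense_homsI[OF dense_carrier]) auto
  have one: "dense_hom_class R E k = \<one>\<^bsub>?Q\<^esub>"
    if E: "(E, restrict k E) \<in> dense_homs R" and k: "\<And>x. x \<in> E \<Longrightarrow> k x = x" for E k
  proof -
    have "E \<subseteq> carrier R" using right_idealD(1)[OF dense_homsD(2)[OF E]] .
    then have "dense_hom_class R E (restrict k E)
        = dense_hom_class R (carrier R) (restrict (\<lambda>x. x) (carrier R))"
      unfolding dense_hom_class_eq_iff[OF E id] using dense_homsD(1)[OF E] k by auto
    then show ?thesis by (simp add: dense_hom_class_restrict_fun one_max_right_quotient_ring)
  qed
  have "dense_hom_class R (h ` D) p \<otimes>\<^bsub>?Q\<^esub> dense_hom_class R D h = \<one>\<^bsub>?Q\<^esub>"
    unfolding mult_dense_hom_class[OF P Dh] by (rule one[OF dense_hom_comp[OF P Dh]]) (simp add: ph)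
  moreover have "dense_hom_class R D h \<otimes>\<^bsub>?Q\<^esub> dense_hom_class R (h ` D) p = \<one>\<^bsub>?Q\<^esub>"
    unfolding mult_dense_hom_class[OF Dh P] by (rule one[OF dense_hom_comp[OF Dh P]]) (simp add: hp)
  ultimately show "dense_hom_class R (h ` D) p \<in> Units ?Q"
    unfolding Units_def
    using dense_hom_class_in_carrier[OF P] dense_hom_class_in_carrier[OF Dh] by blast
qed

text \<open>
  The kernel of \<open>f\<close> is essential in some \<open>e R\<close>, and by nonsingularity \<open>f\<close> vanishes on all of
  \<open>D \<inter> e R\<close>.  Since \<open>e\<close> is central, \<open>f\<close> and multiplication by \<open>e\<close> live on complementary pieces of
  \<open>D\<close>, which makes their sum injective.
\<close>

lemma kernel_complement_injective:
  assumes ab: "abelian_ring R" and C1: "right_C1 R" and ns: "right_nonsingular R"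
    and Df: "(D, f) \<in> dense_homs R"
  obtains e where "idempotent R e" and "\<forall>x\<in>D. f (e \<otimes> x) = \<zero>"
    and "(D, restrict (\<lambda>x. f x \<oplus> e \<otimes> x) D) \<in> dense_homs R"
    and "inj_on (\<lambda>x. f x \<oplus> e \<otimes> x) D"
proof -
  note f = dense_homsD[OF Df]
  note D = right_idealD[OF f(2)]
  let ?K = "{x \<in> D. f x = \<zero>}"
  have "right_ideal R ?K" by (rule right_idealI) (use D f(5,6,7) in auto)
  then obtain e where e: "idempotent R e" and ess: "essential_in R ?K (principal_right_ideal R e)"
    using C1_essential_hull[OF C1] by blast
  have ec: "e \<in> carrier R" "e \<otimes> e = e" using e by (auto simp: idempotent_def)
  have comm: "e \<otimes> x = x \<otimes> e" if "x \<in> D" for x using abelian_ringD[OF ab e] that D(1) by blast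
  have eD: "e \<otimes> x \<in> D" if "x \<in> D" for x using D(5)[OF that ec(1)] comm[OF that] by simp
  have kill: "f (e \<otimes> x) = \<zero>" if x: "x \<in> D" for x
  proof (rule nonsingular_zeroI[OF ns ess])
    show "e \<otimes> x \<in> principal_right_ideal R e"
      using x D(1) by (auto simp: principal_right_ideal_def)
    show "f (e \<otimes> x) \<in> carrier R" using f(4) eD[OF x] by blast
    show "f (e \<otimes> x) \<otimes> r = \<zero>" if "r \<in> carrier R" "e \<otimes> x \<otimes> r \<in> ?K" for r
      using that f(6)[OF eD[OF x] that(1)] by simp
  qed
  let ?h = "\<lambda>x. f x \<oplus> e \<otimes> x"
  have hom: "(D, restrict ?h D) \<in> dense_homs R"
  proof (rule dense_homsI[OF f(1)])
    fix x assume x: "x \<in> D"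
    then have xc: "x \<in> carrier R" using D(1) by blast
    show "?h x \<in> carrier R" using f(4)[OF x] xc ec by simp
    show "?h (x \<otimes> r) = ?h x \<otimes> r" if "r \<in> carrier R" for r
      using f(4)[OF x] xc ec that f(6)[OF x that] by (simp add: l_distr m_assoc)
    fix y assume y: "y \<in> D"
    then have "y \<in> carrier R" using D(1) by blast
    then show "?h (x \<oplus> y) = ?h x \<oplus> ?h y"
      using f(4)[OF x] f(4)[OF y] xc ec f(5)[OF x y] by (simp add: r_distr a_ac)
  qed
  have ker: "x = \<zero>" if x: "x \<in> D" and hx: "?h x = \<zero>" for x
  proof -
    have xc: "x \<in> carrier R" and fc: "f x \<in> carrier R" using x D(1) f(4) by auto
    have fe: "f x \<otimes> e = \<zero>" using kill[OF x] comm[OF x] f(6)[OF x ec(1)] by simp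
    have exe: "e \<otimes> x \<otimes> e = e \<otimes> x"
      using comm[OF eD[OF x]] xc ec by (simp add: m_assoc[symmetric])
    have "\<zero> = ?h x \<otimes> e" using hx ec by simp
    also have "\<dots> = e \<otimes> x" using fe exe xc fc ec by (simp add: l_distr)
    finally have ex: "e \<otimes> x = \<zero>" by simp
    then have "f x = \<zero>" using hx fc by simp
    then have "x \<in> principal_right_ideal R e" using ess x by (auto simp: essential_in_def)
    then show ?thesis using ex e by (simp add: idempotent_principal_right_ideal)
  qed
  have "inj_on ?h D"
  proof (rule inj_onI)
    fix x y assume xy: "x \<in> D" "y \<in> D" and eq: "?h x = ?h y"
    note h = dense_homsD[OF hom]
    have hc: "?h y \<in> carrier R" using h(4)[OF xy(2)] xy by simp
    have "?h (x \<ominus> y) = ?h x \<ominus> ?h y" using h(8)[OF xy] xy D(4)[OF xy] by simp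
    also have "\<dots> = \<zero>" using eq hc by (simp add: a_minus_def r_neg)
    finally have "x \<ominus> y = \<zero>" using ker D(4)[OF xy] by blast
    then show "x = y" using xy D(1) by (metis minus_eq_zero_imp_eq subsetD)
  qed
  then show thesis using that e kill hom by blast
qed

text \<open>
  Let \<open>q\<close> be represented by \<open>f\<close>, and let \<open>h = f + e\<close> be the injective map above.  Its image is
  essential, hence dense, so its inverse \<open>p\<close> represents a unit of the quotient ring.  Because
  \<open>f x = h(x - e x)\<close> and \<open>f\<close> vanishes on \<open>e D\<close>, one gets \<open>f(p(f x)) = f(x - e x) = f x\<close>.
\<close>

lemma nonsingular_imp_unit_regular_quotient:
  assumes ab: "abelian_ring R" and C1: "right_C1 R" and ns: "right_nonsingular R"
  shows "unit_regular (max_right_quotient_ring R)"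
  unfolding unit_regular_def
proof
  let ?Q = "max_right_quotient_ring R"
  fix q assume "q \<in> carrier ?Q"
  then obtain D f where Df: "(D, f) \<in> dense_homs R" and q: "q = dense_hom_class R D f"
    by (rule carrier_max_right_quotient_ringE)
  note f = dense_homsD[OF Df]
  note D = right_idealD[OF f(2)]
  obtain e where e: "idempotent R e" and kill: "\<forall>x\<in>D. f (e \<otimes> x) = \<zero>"
    and hom: "(D, restrict (\<lambda>x. f x \<oplus> e \<otimes> x) D) \<in> dense_homs R"
    and inj: "inj_on (\<lambda>x. f x \<oplus> e \<otimes> x) D"
    using kernel_complement_injective[OF ab C1 ns Df] .
  have ec: "e \<in> carrier R" "e \<otimes> e = e" using e by (auto simp: idempotent_def)
  define h where "h = restrict (\<lambda>x. f x \<oplus> e \<otimes> x) D"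
  have Dh: "(D, h) \<in> dense_homs R" and inj_h: "inj_on h D"
    using hom inj by (auto simp: h_def inj_on_def)
  have dense: "dense_right_ideal R (h ` D)"
    using nonsingular_essential_imp_dense[OF ns] injective_dense_hom_image_essential[OF ab C1 Dh inj_h]
    by blast
  define p where "p = restrict (inv_into D h) (h ` D)"
  have P: "(h ` D, p) \<in> dense_homs R" and unit: "dense_hom_class R (h ` D) p \<in> Units ?Q"
    unfolding p_def using injective_dense_hom_unit[OF Dh inj_h dense] by auto
  have fx: "f x \<in> h ` D \<and> p (f x) \<in> D \<and> f (p (f x)) = f x" if x: "x \<in> D" for x
  proof -
    have xc: "x \<in> carrier R" and fc: "f x \<in> carrier R" using x D(1) f(4) by auto
    have ex: "e \<otimes> x \<in> D" using D(5)[OF x ec(1)] abelian_ringD[OF ab e xc] by simp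
    let ?z = "x \<ominus> e \<otimes> x"
    have z: "?z \<in> D" using D(4)[OF x ex] .
    have fz: "f ?z = f x" using f(8)[OF x ex] kill x fc by (simp add: a_minus_def)
    have "e \<otimes> ?z = \<zero>" using xc ec by (simp add: a_minus_def r_distr r_minus m_assoc[symmetric] r_neg)
    then have hz: "h ?z = f x" using z fz fc by (simp add: h_def)
    then have "p (f x) = ?z" using inj_h z by (metis p_def imageI inv_into_f_f restrict_apply')
    then show ?thesis using hz z fz by (metis imageI)
  qed
  have "q = q \<otimes>\<^bsub>?Q\<^esub> dense_hom_class R (h ` D) p \<otimes>\<^bsub>?Q\<^esub> q"
    unfolding q dense_hom_class_quasi_inverse_iff[OF Df P]
    by (intro exI[of _ D] conjI f(1)) (use fx in auto)
  then show "\<exists>u\<in>Units ?Q. q = q \<otimes>\<^bsub>?Q\<^esub> u \<otimes>\<^bsub>?Q\<^esub> q"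
    by (rule bexI[OF _ unit])
qed

end

theorem corollary4p3:
  fixes R (structure)
  assumes "ring R"
    and "abelian_ring R"
    and "right_quasi_continuous R"
  shows "(uniquely_special_almost_clean R \<longleftrightarrow> right_nonsingular R) \<and>
         (uniquely_special_almost_clean R \<longleftrightarrow> unit_regular (max_right_quotient_ring R)) \<and>
         (uniquely_special_almost_clean R \<longleftrightarrow> rickart R)"
proof -
  interpret ring R by fact
  have C1: "right_C1 R" using assms(3) by (simp add: right_quasi_continuous_def)
  have "uniquely_special_almost_clean R \<longleftrightarrow> right_rickart R"
    using uniquely_special_almost_clean_iff_right_rickart[OF assms(2)] .
  moreover have "rickart R \<longleftrightarrow> right_rickart R"
    using abelian_right_rickart_imp_rickart[OF assms(2)] by (auto simp: rickart_def)
  moreover have "right_nonsingular R \<longleftrightarrow> right_rickart R"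
    using nonsingular_C1_right_rickart[OF _ C1] right_rickart_imp_nonsingular by blast
  moreover have "unit_regular (max_right_quotient_ring R) \<longleftrightarrow> right_nonsingular R"
    using nonsingular_imp_unit_regular_quotient[OF assms(2) C1]
      unit_regular_quotient_imp_nonsingular by blast
  ultimately show ?thesis by blast
qed

end
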